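(* (i) Let $A\in M(n,\widetilde{\mathbb C})$ and $\lambda\in\widetilde{\mathbb C}$. Then $\lambda$ is an eigenvalue of $A$ if and only if $\det(A-\lambda I)=0$. (ii) Eigenvalues of invertible matrices are invertible: if $A\in M(n,\widetilde{\mathbb C})$ is invertible and $\lambda\in\widetilde{\mathbb C}$ is an eigenvalue of $A$, then $\lambda$ is invertible in $\widetilde{\mathbb C}$. (iii) If $A\in M(2n,\widetilde{\mathbb R})$ is a symplectic matrix, then, for invertible $\lambda\in\widetilde{\mathbb C}$, $\lambda$ is an eigenvalue of $A$ (regarded as an element of $M(2n,\widetilde{\mathbb C})$) if and only if $\lambda^{-1}$ is.
   Context: For $\mathbb K=\mathbb R$ or $\mathbb C$, the ring of Colombeau generalized numbers is $\widetilde{\mathbb K}=\mathcal E_M/\mathcal N$, where $\mathcal E_M=\{(r_\varepsilon)_{\varepsilon\in(0,1]}\in\mathbb K^{(0,1]}:\exists N\in\mathbb N,\ |r_\varepsilon|=O(\varepsilon^{-N})\ (\varepsilon\to0)\}$ and $\mathcal N=\{(r_\varepsilon)_{\varepsilon\in(0,1]}\in\mathbb K^{(0,1]}:\forall m\in\mathbb N,\ |r_\varepsilon|=O(\varepsilon^{m})\ (\varepsilon\to0)\}$, with operations defined componentwise on representatives; it is a commutative ring with unit, and $\widetilde{\mathbb R}\subseteq\widetilde{\mathbb C}$. $M(n,\widetilde{\mathbb K})$ is the set of $n\times n$ matrices with entries in $\widetilde{\mathbb K}$, and $I$ denotes the identity matrix. A vector $x\in\widetilde{\mathbb C}^n$ is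 free if $\{x\}$ is linearly independent over $\widetilde{\mathbb C}$, i.e., $\mu x=0$ with $\mu\in\widetilde{\mathbb C}$ implies $\mu=0$. A generalized complex number $\lambda\in\widetilde{\mathbb C}$ is an eigenvalue of $A\in M(n,\widetilde{\mathbb C})$ if there exists a free vector $x\in\widetilde{\mathbb C}^n$ such that $Ax=\lambda x$. A matrix $A\in M(2n,\widetilde{\mathbb R})$ is symplectic if $A^tJA=J$, where $J=\begin{pmatrix}0&-I_n\\ I_n&0\end{pmatrix}$. *)

theory Defs
  imports "HOL-Analysis.Analysis" "HOL-Library.Landau_Symbols"
begin

text \<open>
  Nets are represented by functions on all reals. Both predicates below only constrain their
  argument near 0 from the right, so the values outside \<open>{0<..1}\<close> (as well as those away from 0)
  are irrelevant to them, and the quotient is the same as that of nets indexed by \<open>{0<..1}\<close>.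
\<close>

definition moderate_net :: "(real \<Rightarrow> 'a::real_normed_field) \<Rightarrow> bool" where
  "moderate_net r \<longleftrightarrow> (\<exists>N::nat. (\<lambda>\<epsilon>. norm (r \<epsilon>)) \<in> O[at_right 0](\<lambda>\<epsilon>. 1 / \<epsilon> ^ N))"

definition negligible_net :: "(real \<Rightarrow> 'a::real_normed_field) \<Rightarrow> bool" where
  "negligible_net r \<longleftrightarrow> (\<forall>m::nat. (\<lambda>\<epsilon>. norm (r \<epsilon>)) \<in> O[at_right 0](\<lambda>\<epsilon>. \<epsilon> ^ m))"

definition colombeau_rel ::
    "(real \<Rightarrow> 'a::real_normed_field) \<Rightarrow> (real \<Rightarrow> 'a) \<Rightarrow> bool" where
  "colombeau_rel r s \<longleftrightarrow>
     moderate_net r \<and> moderate_net s \<and> negligible_net (\<lambda>\<epsilon>. r \<epsilon> - s \<epsilon>)"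

lemma inverse_power_bigo_mono:
  assumes "M \<le> N"
  shows "(\<lambda>\<epsilon>::real. 1 / \<epsilon> ^ M) \<in> O[at_right 0](\<lambda>\<epsilon>. 1 / \<epsilon> ^ N)"
proof (rule bigoI[of _ 1])
  have "eventually (\<lambda>\<epsilon>::real. \<epsilon> \<in> {0<..<1}) (at_right 0)"
    by (rule eventually_at_right_real) simp
  then show "\<forall>\<^sub>F \<epsilon>::real in at_right 0. norm (1 / \<epsilon> ^ M) \<le> 1 * norm (1 / \<epsilon> ^ N)"
  proof eventually_elim
    case (elim \<epsilon>)
    then have "\<epsilon> ^ N \<le> \<epsilon> ^ M" using assms by (intro power_decreasing) auto
    then show ?case using elim by (simp add: frac_le)
  qed
qed

lemma moderate_net_const: "moderate_net (\<lambda>_. c)"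
  unfolding moderate_net_def by (rule exI[of _ 0]) simp

lemma moderate_net_add:
  assumes "moderate_net r" "moderate_net s"
  shows "moderate_net (\<lambda>\<epsilon>. r \<epsilon> + s \<epsilon>)"
proof -
  obtain M N where
    "(\<lambda>\<epsilon>. norm (r \<epsilon>)) \<in> O[at_right 0](\<lambda>\<epsilon>. 1 / \<epsilon> ^ M)"
    "(\<lambda>\<epsilon>. norm (s \<epsilon>)) \<in> O[at_right 0](\<lambda>\<epsilon>. 1 / \<epsilon> ^ N)"
    using assms unfolding moderate_net_def by blast
  then have "(\<lambda>\<epsilon>. norm (r \<epsilon>)) \<in> O[at_right 0](\<lambda>\<epsilon>. 1 / \<epsilon> ^ (M + N))"
    "(\<lambda>\<epsilon>. norm (s \<epsilon>)) \<in> O[at_right 0](\<lambda>\<epsilon>. 1 / \<epsilon> ^ (M + N))"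
    using inverse_power_bigo_mono[of M "M + N"] inverse_power_bigo_mono[of N "M + N"]
    by (auto intro: landau_o.big_trans)
  then have "(\<lambda>\<epsilon>. norm (r \<epsilon>) + norm (s \<epsilon>)) \<in> O[at_right 0](\<lambda>\<epsilon>. 1 / \<epsilon> ^ (M + N))"
    by (rule sum_in_bigo)
  moreover have "(\<lambda>\<epsilon>. norm (r \<epsilon> + s \<epsilon>)) \<in> O[at_right 0](\<lambda>\<epsilon>. norm (r \<epsilon>) + norm (s \<epsilon>))"
    by (rule bigoI[of _ 1]) (simp add: norm_triangle_ineq)
  ultimately show ?thesis
    unfolding moderate_net_def by (blast intro: landau_o.big_trans)
qed

lemma moderate_net_uminus: "moderate_net r \<Longrightarrow> moderate_net (\<lambda>\<epsilon>. - r \<epsilon>)"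
  unfolding moderate_net_def by simp

lemma moderate_net_mult:
  assumes "moderate_net r" "moderate_net s"
  shows "moderate_net (\<lambda>\<epsilon>. r \<epsilon> * s \<epsilon>)"
proof -
  obtain M N where
    "(\<lambda>\<epsilon>. norm (r \<epsilon>)) \<in> O[at_right 0](\<lambda>\<epsilon>. 1 / \<epsilon> ^ M)"
    "(\<lambda>\<epsilon>. norm (s \<epsilon>)) \<in> O[at_right 0](\<lambda>\<epsilon>. 1 / \<epsilon> ^ N)"
    using assms unfolding moderate_net_def by blast
  then have "(\<lambda>\<epsilon>. norm (r \<epsilon>) * norm (s \<epsilon>)) \<in> O[at_right 0](\<lambda>\<epsilon>. 1 / \<epsilon> ^ M * (1 / \<epsilon> ^ N))"
    by (rule landau_o.big.mult)
  then show ?thesis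
    unfolding moderate_net_def by (intro exI[of _ "M + N"]) (simp add: norm_mult power_add)
qed

lemma negligible_net_zero: "negligible_net (\<lambda>_. 0)"
  unfolding negligible_net_def by simp

lemma negligible_net_add:
  assumes "negligible_net r" "negligible_net s"
  shows "negligible_net (\<lambda>\<epsilon>. r \<epsilon> + s \<epsilon>)"
  unfolding negligible_net_def
proof
  fix m :: nat
  have "(\<lambda>\<epsilon>. norm (r \<epsilon>) + norm (s \<epsilon>)) \<in> O[at_right 0](\<lambda>\<epsilon>. \<epsilon> ^ m)"
    using assms unfolding negligible_net_def by (intro sum_in_bigo) auto
  moreover have "(\<lambda>\<epsilon>. norm (r \<epsilon> + s \<epsilon>)) \<in> O[at_right 0](\<lambda>\<epsilon>. norm (r \<epsilon>) + norm (s \<epsilon>))"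
    by (rule bigoI[of _ 1]) (simp add: norm_triangle_ineq)
  ultimately show "(\<lambda>\<epsilon>. norm (r \<epsilon> + s \<epsilon>)) \<in> O[at_right 0](\<lambda>\<epsilon>. \<epsilon> ^ m)"
    by (blast intro: landau_o.big_trans)
qed

lemma negligible_net_uminus: "negligible_net r \<Longrightarrow> negligible_net (\<lambda>\<epsilon>. - r \<epsilon>)"
  unfolding negligible_net_def by simp

lemma negligible_net_mult:
  assumes "moderate_net r" "negligible_net s"
  shows "negligible_net (\<lambda>\<epsilon>. r \<epsilon> * s \<epsilon>)"
  unfolding negligible_net_def
proof
  fix m :: nat
  obtain N where "(\<lambda>\<epsilon>. norm (r \<epsilon>)) \<in> O[at_right 0](\<lambda>\<epsilon>. 1 / \<epsilon> ^ N)"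
    using assms unfolding moderate_net_def by blast
  moreover have "(\<lambda>\<epsilon>. norm (s \<epsilon>)) \<in> O[at_right 0](\<lambda>\<epsilon>. \<epsilon> ^ (m + N))"
    using assms unfolding negligible_net_def by blast
  ultimately have
    "(\<lambda>\<epsilon>. norm (r \<epsilon>) * norm (s \<epsilon>)) \<in> O[at_right 0](\<lambda>\<epsilon>. 1 / \<epsilon> ^ N * \<epsilon> ^ (m + N))"
    by (rule landau_o.big.mult)
  also have "(\<lambda>\<epsilon>::real. 1 / \<epsilon> ^ N * \<epsilon> ^ (m + N)) \<in> O[at_right 0](\<lambda>\<epsilon>. \<epsilon> ^ m)"
  proof (rule bigoI[of _ 1])
    have "eventually (\<lambda>\<epsilon>::real. \<epsilon> \<in> {0<..<1}) (at_right 0)"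
      by (rule eventually_at_right_real) simp
    then show "\<forall>\<^sub>F \<epsilon>::real in at_right 0. norm (1 / \<epsilon> ^ N * \<epsilon> ^ (m + N)) \<le> 1 * norm (\<epsilon> ^ m)"
      by eventually_elim (simp add: power_add)
  qed
  finally show "(\<lambda>\<epsilon>. norm (r \<epsilon> * s \<epsilon>)) \<in> O[at_right 0](\<lambda>\<epsilon>. \<epsilon> ^ m)"
    by (simp add: norm_mult)
qed

lemma not_negligible_net_one: "\<not> negligible_net (\<lambda>_. 1 :: 'a::real_normed_field)"
proof
  assume "negligible_net (\<lambda>_. 1 :: 'a)"
  then have "(\<lambda>_. 1 :: real) \<in> O[at_right 0](\<lambda>\<epsilon>. \<epsilon> ^ 1)"
    unfolding negligible_net_def by (metis (no_types, lifting) norm_one landau_o.big.cong_ex ext)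
  then obtain c where c: "c > 0" "\<forall>\<^sub>F \<epsilon>::real in at_right 0. 1 \<le> c * \<bar>\<epsilon>\<bar>"
    by (auto elim!: landau_o.bigE)
  have "\<forall>\<^sub>F \<epsilon>::real in at_right 0. \<epsilon> \<in> {0<..<1 / c}"
    by (rule eventually_at_right_real) (use c in simp)
  with c(2) have "\<forall>\<^sub>F \<epsilon>::real in at_right 0. False"
    by eventually_elim (use c(1) in \<open>auto simp: field_simps\<close>)
  then show False by simp
qed

quotient_type (overloaded) 'a colombeau = "real \<Rightarrow> 'a::real_normed_field" / partial: colombeau_rel
proof (rule part_equivpI)
  show "\<exists>r::real \<Rightarrow> 'a. colombeau_rel r r"
    by (rule exI[of _ "\<lambda>_. 0"])
      (simp add: colombeau_rel_def moderate_net_const negligible_net_zero)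
  show "symp (colombeau_rel :: (real \<Rightarrow> 'a) \<Rightarrow> _)"
  proof (rule sympI)
    fix r s :: "real \<Rightarrow> 'a"
    assume "colombeau_rel r s"
    then show "colombeau_rel s r"
      unfolding colombeau_rel_def
      using negligible_net_uminus[of "\<lambda>\<epsilon>. r \<epsilon> - s \<epsilon>"] by simp
  qed
  show "transp (colombeau_rel :: (real \<Rightarrow> 'a) \<Rightarrow> _)"
  proof (rule transpI)
    fix r s t :: "real \<Rightarrow> 'a"
    assume "colombeau_rel r s" "colombeau_rel s t"
    then show "colombeau_rel r t"
      unfolding colombeau_rel_def
      using negligible_net_add[of "\<lambda>\<epsilon>. r \<epsilon> - s \<epsilon>" "\<lambda>\<epsilon>. s \<epsilon> - t \<epsilon>"] by simp
  qed
qed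

instantiation colombeau :: (real_normed_field) comm_ring_1
begin

lift_definition zero_colombeau :: "'a colombeau" is "\<lambda>_. 0"
  by (simp add: colombeau_rel_def moderate_net_const negligible_net_zero)

lift_definition one_colombeau :: "'a colombeau" is "\<lambda>_. 1"
  by (simp add: colombeau_rel_def moderate_net_const negligible_net_zero)

lift_definition plus_colombeau :: "'a colombeau \<Rightarrow> 'a colombeau \<Rightarrow> 'a colombeau"
  is "\<lambda>r s \<epsilon>. r \<epsilon> + s \<epsilon>"
proof -
  fix r r' s s' :: "real \<Rightarrow> 'a"
  assume "colombeau_rel r r'" "colombeau_rel s s'"
  then show "colombeau_rel (\<lambda>\<epsilon>. r \<epsilon> + s \<epsilon>) (\<lambda>\<epsilon>. r' \<epsilon> + s' \<epsilon>)"
    unfolding colombeau_rel_def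
    using negligible_net_add[of "\<lambda>\<epsilon>. r \<epsilon> - r' \<epsilon>" "\<lambda>\<epsilon>. s \<epsilon> - s' \<epsilon>"]
    by (auto intro: moderate_net_add simp: algebra_simps)
qed

lift_definition uminus_colombeau :: "'a colombeau \<Rightarrow> 'a colombeau"
  is "\<lambda>r \<epsilon>. - r \<epsilon>"
proof -
  fix r r' :: "real \<Rightarrow> 'a"
  assume "colombeau_rel r r'"
  then show "colombeau_rel (\<lambda>\<epsilon>. - r \<epsilon>) (\<lambda>\<epsilon>. - r' \<epsilon>)"
    unfolding colombeau_rel_def
    using negligible_net_uminus[of "\<lambda>\<epsilon>. r \<epsilon> - r' \<epsilon>"]
    by (auto intro: moderate_net_uminus simp: algebra_simps)
qed

lift_definition minus_colombeau :: "'a colombeau \<Rightarrow> 'a colombeau \<Rightarrow> 'a colombeau"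
  is "\<lambda>r s \<epsilon>. r \<epsilon> - s \<epsilon>"
proof -
  fix r r' s s' :: "real \<Rightarrow> 'a"
  assume *: "colombeau_rel r r'" "colombeau_rel s s'"
  have "moderate_net (\<lambda>\<epsilon>. r \<epsilon> + - s \<epsilon>)" "moderate_net (\<lambda>\<epsilon>. r' \<epsilon> + - s' \<epsilon>)"
    using * unfolding colombeau_rel_def
    by (intro moderate_net_add moderate_net_uminus; simp)+
  moreover have "negligible_net (\<lambda>\<epsilon>. (r \<epsilon> - r' \<epsilon>) + - (s \<epsilon> - s' \<epsilon>))"
    using * unfolding colombeau_rel_def
    by (intro negligible_net_add negligible_net_uminus) auto
  ultimately show "colombeau_rel (\<lambda>\<epsilon>. r \<epsilon> - s \<epsilon>) (\<lambda>\<epsilon>. r' \<epsilon> - s' \<epsilon>)"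
    unfolding colombeau_rel_def by (simp add: algebra_simps)
qed

lift_definition times_colombeau :: "'a colombeau \<Rightarrow> 'a colombeau \<Rightarrow> 'a colombeau"
  is "\<lambda>r s \<epsilon>. r \<epsilon> * s \<epsilon>"
proof -
  fix r r' s s' :: "real \<Rightarrow> 'a"
  assume *: "colombeau_rel r r'" "colombeau_rel s s'"
  then have "negligible_net (\<lambda>\<epsilon>. r \<epsilon> * (s \<epsilon> - s' \<epsilon>) + s' \<epsilon> * (r \<epsilon> - r' \<epsilon>))"
    unfolding colombeau_rel_def by (intro negligible_net_add negligible_net_mult) auto
  then have "negligible_net (\<lambda>\<epsilon>. r \<epsilon> * s \<epsilon> - r' \<epsilon> * s' \<epsilon>)"
    by (simp add: algebra_simps)
  with * show "colombeau_rel (\<lambda>\<epsilon>. r \<epsilon> * s \<epsilon>) (\<lambda>\<epsilon>. r' \<epsilon> * s' \<epsilon>)"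
    unfolding colombeau_rel_def by (blast intro: moderate_net_mult)
qed

instance
proof
  fix a b c :: "'a colombeau"
  show "a * b * c = a * (b * c)"
    by transfer (auto simp: colombeau_rel_def negligible_net_zero mult.assoc intro!: moderate_net_mult)
  show "a * b = b * a"
    by transfer (auto simp: colombeau_rel_def negligible_net_zero mult.commute intro!: moderate_net_mult)
  show "1 * a = a"
    by transfer (auto simp: colombeau_rel_def negligible_net_zero)
  show "a + b + c = a + (b + c)"
    by transfer (auto simp: colombeau_rel_def negligible_net_zero add.assoc intro!: moderate_net_add)
  show "a + b = b + a"
    by transfer (auto simp: colombeau_rel_def negligible_net_zero add.commute intro!: moderate_net_add)
  show "0 + a = a"
    by transfer (auto simp: colombeau_rel_def negligible_net_zero)
  show "- a + a = 0"
    by transfer (auto simp: colombeau_rel_def negligible_net_zero moderate_net_const)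
  show "a - b = a + - b"
  proof transfer
    fix r s :: "real \<Rightarrow> 'a"
    assume "colombeau_rel r r" "colombeau_rel s s"
    then have "moderate_net (\<lambda>\<epsilon>. r \<epsilon> + - s \<epsilon>)"
      unfolding colombeau_rel_def by (intro moderate_net_add moderate_net_uminus) auto
    then show "colombeau_rel (\<lambda>\<epsilon>. r \<epsilon> - s \<epsilon>) (\<lambda>\<epsilon>. r \<epsilon> + - s \<epsilon>)"
      by (simp add: colombeau_rel_def negligible_net_zero)
  qed
  show "(a + b) * c = a * c + b * c"
    by transfer (auto simp: colombeau_rel_def negligible_net_zero distrib_right
        intro!: moderate_net_add moderate_net_mult)
  show "(0 :: 'a colombeau) \<noteq> 1"
  proof transfer
    have "\<not> negligible_net (\<lambda>_. 0 - 1 :: 'a)"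
      using negligible_net_uminus[of "\<lambda>_. - 1 :: 'a"] not_negligible_net_one by auto
    then show "\<not> colombeau_rel (\<lambda>_. 0 :: 'a) (\<lambda>_. 1)"
      by (simp add: colombeau_rel_def)
  qed
qed

end

lift_definition complex_of_colombeau :: "real colombeau \<Rightarrow> complex colombeau"
  is "\<lambda>r \<epsilon>. complex_of_real (r \<epsilon>)"
  by (simp add: colombeau_rel_def moderate_net_def negligible_net_def flip: of_real_diff)

definition complex_matrix_of_colombeau ::
    "real colombeau ^ 'n ^ 'm \<Rightarrow> complex colombeau ^ 'n ^ 'm" where
  "complex_matrix_of_colombeau A = (\<chi> i j. complex_of_colombeau (A $ i $ j))"

definition free_vector :: "'a::comm_ring_1 ^ 'n \<Rightarrow> bool" where
  "free_vector x \<longleftrightarrow> (\<forall>\<mu>. \<mu> *s x = 0 \<longrightarrow> \<mu> = 0)"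

definition gen_eigenvalue :: "complex colombeau ^ 'n ^ 'n \<Rightarrow> complex colombeau \<Rightarrow> bool" where
  "gen_eigenvalue A l \<longleftrightarrow> (\<exists>x. free_vector x \<and> A *v x = l *s x)"

text \<open>
  Matrices of even size $2n$ are indexed by \<open>'n + 'n\<close>, with \<open>Inl\<close> for the first and \<open>Inr\<close> for the
  last $n$ indices.
\<close>

definition symplectic_J :: "'a::comm_ring_1 ^ ('n::finite + 'n) ^ ('n + 'n)" where
  "symplectic_J = (\<chi> i j. case (i, j) of
       (Inl a, Inr b) \<Rightarrow> if a = b then - 1 else 0
     | (Inr a, Inl b) \<Rightarrow> if a = b then 1 else 0
     | _ \<Rightarrow> 0)"

definition symplectic_matrix :: "real colombeau ^ ('n::finite + 'n) ^ ('n + 'n) \<Rightarrow> bool" where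
  "symplectic_matrix A \<longleftrightarrow> transpose A ** symplectic_J ** A = symplectic_J"

end

theory Submission
  imports Defs
begin

text \<open>
  A free vector in the kernel of \<open>B\<close> is annihilated by \<open>det B\<close> (Cramer), so \<open>det B = 0\<close>. Conversely,
  every matrix over the base field has a vector \<open>x\<close> of sup norm 1 with
  \<open>norm ((B *v x) $ i) ^ n \<le> n! * norm (det B)\<close>. If \<open>det B\<close> is negligible, choosing such a vector
  for each \<open>\<epsilon>\<close> gives a moderate net, which is free because of its sup norm and which \<open>B\<close> maps to 0.
  The remaining claims are then about determinants over a commutative ring: \<open>l\<close> divides
  \<open>det A - det (A - mat l)\<close>, and \<open>transpose A\<close> is conjugate to the inverse of a symplectic \<open>A\<close>.
\<close>

section \<open>Determinants over commutative rings\<close>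

text \<open>Cramer's rule: putting \<open>A *v x\<close> in place of column k of \<open>A\<close>
  gives determinant \<open>x $ k * det A\<close> by multilinearity, and 0 because
  \<open>A *v x\<close> is 0. Nothing is cancelled, so zero divisors do no harm.\<close>

lemma det_vector_mult_eq_zero:
  fixes A :: "'a::comm_ring_1 ^ 'n ^ 'n"
  assumes "A *v x = 0"
  shows "det A *s x = 0"
proof -
  have "x $ k * det A = 0" for k
  proof -
    \<comment> \<open>Column k is replaced by \<open>v\<close>. The matrix is written transposed,
      with columns of \<open>A\<close> as rows, so that linearity in a row applies.\<close>
    let ?D = "\<lambda>v. det (\<chi> i. if i = k then v else column i A)"
    have A: "(\<chi> i. if i = k then column k A else column i A) = transpose A"
      by (simp add: vec_eq_iff transpose_def column_def)
    have D0: "?D (column j A) = 0" if "j \<noteq> k" for j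
      by (rule det_identical_rows[OF that]) (use that in \<open>simp add: row_def\<close>)
    have "?D (A *v x) = (\<Sum>j\<in>UNIV. x $ j * ?D (column j A))"
      by (simp only: matrix_mult_sum det_linear_row_sum[OF finite] det_row_mul)
    also have "\<dots> = (\<Sum>j\<in>UNIV. if j = k then x $ k * det A else 0)"
      by (rule sum.cong) (auto simp: D0 A)
    finally show ?thesis
      unfolding assms det_row_0 by simp
  qed
  then show ?thesis
    by (simp add: vec_eq_iff mult.commute)
qed

text \<open>Congruence modulo \<open>d\<close> is compatible with products; the induction step
  splits fF - gG as (f - g)F + g(F - G).\<close>

lemma dvd_prod_diff:
  fixes f g :: "'b \<Rightarrow> 'a::comm_ring_1"
  assumes "\<And>i. i \<in> S \<Longrightarrow> d dvd f i - g i"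
  shows "d dvd prod f S - prod g S"
  using assms
proof (induction S rule: infinite_finite_induct)
  case (insert i S)
  then have "d dvd (f i - g i) * prod f S + g i * (prod f S - prod g S)"
    by (intro dvd_add dvd_mult dvd_mult2) auto
  then show ?case
    using insert.hyps by (simp add: algebra_simps)
qed simp_all

text \<open>The determinant is a polynomial in the entries with integer coefficients, so congruences
  modulo \<open>d\<close> pass through the Leibniz formula term by term.\<close>

lemma dvd_det_diff:
  fixes A B :: "'a::comm_ring_1 ^ 'n ^ 'n"
  assumes "\<And>i j. d dvd A $ i $ j - B $ i $ j"
  shows "d dvd det A - det B"
proof -
  have "det A - det B = (\<Sum>p | p permutes (UNIV :: 'n set).
      of_int (sign p) * ((\<Prod>i\<in>UNIV. A $ i $ p i) - (\<Prod>i\<in>UNIV. B $ i $ p i)))"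
    by (simp add: det_def sum_subtractf right_diff_distrib)
  also have "d dvd \<dots>"
    by (intro dvd_sum dvd_mult dvd_prod_diff assms)
  finally show ?thesis .
qed

lemma det_invertible_dvd_one:
  fixes A :: "'a::comm_ring_1 ^ 'n ^ 'n"
  assumes "invertible A"
  shows "det A dvd 1"
  using assms det_mul[of A] unfolding invertible_def by (metis det_I dvd_triv_left)

section \<open>Determinant bounds and almost null vectors over a normed field\<close>

lemma norm_det_le:
  fixes A :: "'a::{real_normed_field} ^ 'n ^ 'n"
  assumes "\<And>i j. norm (A $ i $ j) \<le> M"
  shows "norm (det A) \<le> fact CARD('n) * M ^ CARD('n)"
proof -
  have "norm (det A) \<le> (\<Sum>p | p permutes (UNIV :: 'n set). M ^ CARD('n))"
    unfolding det_def
  proof (rule sum_norm_le)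
    fix p :: "'n \<Rightarrow> 'n"
    have "norm (of_int (sign p) * (\<Prod>i\<in>UNIV. A $ i $ p i)) = (\<Prod>i\<in>UNIV. norm (A $ i $ p i))"
      by (simp add: norm_mult prod_norm sign_def)
    also have "\<dots> \<le> (\<Prod>i\<in>(UNIV :: 'n set). M)"
      by (intro prod_mono) (use assms in auto)
    finally show "norm (of_int (sign p) * (\<Prod>i\<in>UNIV. A $ i $ p i)) \<le> M ^ CARD('n)"
      by simp
  qed
  then show ?thesis
    by (simp add: card_permutations)
qed

lemma ex_maximal_value:
  fixes f :: "'b::finite \<Rightarrow> 'a::linorder"
  shows "\<exists>i. \<forall>j. f j \<le> f i"
proof -
  have "Max (range f) \<in> range f" by (rule Max_in) auto
  then obtain i where "Max (range f) = f i" by (rule rangeE)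
  then show ?thesis by (metis Max_ge finite finite_imageI rangeI)
qed

text \<open>
  If \<open>A\<close> is regular, take the column of the inverse that contains its largest entry \<open>M\<close>, divided
  by \<open>M\<close>: then \<open>A *v x\<close> has a single nonzero entry \<open>1 / M\<close>, and \<open>norm_det_le\<close> for the inverse bounds
  \<open>M\<close> from below.
\<close>

lemma ex_almost_null_vector:
  fixes A :: "'a::real_normed_field ^ 'n ^ 'n"
  shows "\<exists>x. (\<forall>i. norm (x $ i) \<le> 1) \<and> (\<exists>i. norm (x $ i) = 1) \<and>
    (\<forall>i. norm ((A *v x) $ i) ^ CARD('n) \<le> fact CARD('n) * norm (det A))"
proof -
  have normalize: "\<exists>i. y $ i \<noteq> 0 \<and> (\<forall>j. norm (y $ j) \<le> norm (y $ i))"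
    if "y \<noteq> 0" for y :: "'a ^ 'n"
  proof -
    obtain i where "\<And>j. norm (y $ j) \<le> norm (y $ i)"
      using ex_maximal_value[of "\<lambda>i. norm (y $ i)"] by blast
    moreover from that obtain j where "y $ j \<noteq> 0" by (auto simp: vec_eq_iff)
    ultimately show ?thesis
      by (metis norm_le_zero_iff norm_zero)
  qed
  show ?thesis
  proof (cases "invertible A")
    case False
    then obtain y where y: "y \<noteq> 0" "A *v y = 0"
      by (metis invertible_left_inverse matrix_left_invertible_ker)
    then obtain i where i: "y $ i \<noteq> 0" "\<And>j. norm (y $ j) \<le> norm (y $ i)"
      using normalize by blast
    \<comment> \<open>Dividing a kernel vector by an entry of largest norm gives sup norm 1. The
      bound on the image is then trivial, since the exponent is positive.\<close>
    have "A *v (inverse (y $ i) *s y) = 0"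
      by (simp add: y vector_scalar_commute)
    moreover have "norm ((inverse (y $ i) *s y) $ j) \<le> 1" for j
      using i by (simp add: norm_mult norm_inverse norm_divide inverse_eq_divide)
    moreover have "norm ((inverse (y $ i) *s y) $ i) = 1"
      using i by (simp add: norm_mult norm_inverse)
    ultimately show ?thesis
      by (intro exI[of _ "inverse (y $ i) *s y"]) (auto simp: zero_power)
  next
    case True
    then obtain B where B: "A ** B = mat 1" by (auto simp: invertible_def)
    obtain k l where kl: "\<And>i j. norm (B $ i $ j) \<le> norm (B $ k $ l)"
      using ex_maximal_value[of "\<lambda>(i, j). norm (B $ i $ j)"] by auto
    define b where "b = B $ k $ l"
    have le: "norm (B $ i $ j) \<le> norm b" for i j
      unfolding b_def by (rule kl)
    have det: "norm (det A) * norm (det B) = 1"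
      using B by (metis det_I det_mul norm_mult norm_one)
    have "norm (det B) \<le> fact CARD('n) * norm b ^ CARD('n)"
      by (rule norm_det_le) (rule le)
    then have "norm (det A) * norm (det B) \<le> norm (det A) * (fact CARD('n) * norm b ^ CARD('n))"
      by (rule mult_left_mono) simp
    with det have bound: "1 \<le> norm (det A) * (fact CARD('n) * norm b ^ CARD('n))" by simp
    \<comment> \<open>For \<open>b = 0\<close> the right side of \<open>bound\<close> would be 0, as
      \<open>CARD('n)\<close> is positive.\<close>
    then have b0: "b \<noteq> 0" by (auto simp: zero_power)
    define x where "x = inverse b *s column l B"
    have "A *v column l B = axis l 1"
      using B by (simp add: vec_eq_iff matrix_matrix_mult_def matrix_vector_mult_def column_def
          mat_def axis_def)
    then have Ax: "A *v x = inverse b *s axis l 1"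
      by (simp add: x_def vector_scalar_commute)
    have "norm ((A *v x) $ i) \<le> inverse (norm b)" for i
      by (simp add: Ax axis_def norm_inverse)
    then have "norm ((A *v x) $ i) ^ CARD('n) \<le> inverse (norm b) ^ CARD('n)" for i
      by (intro power_mono) auto
    moreover have "inverse (norm b) ^ CARD('n) \<le> fact CARD('n) * norm (det A)"
      using bound b0 by (simp add: field_simps)
    ultimately have "norm ((A *v x) $ i) ^ CARD('n) \<le> fact CARD('n) * norm (det A)" for i
      by (rule order_trans)
    moreover have "norm (x $ i) \<le> 1" for i
      using le[of i l] b0 by (simp add: x_def column_def norm_mult norm_inverse norm_divide inverse_eq_divide)
    moreover have "norm (x $ k) = 1"
      using b0 by (simp add: x_def column_def norm_mult norm_inverse b_def)
    ultimately show ?thesis by blast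
  qed
qed

section \<open>Calculating with representatives\<close>

text \<open>\<open>cr_colombeau r a\<close>, which comes with the quotient type, says that the net \<open>r\<close> represents \<open>a\<close>.\<close>

lemma cr_colombeau_iff: "cr_colombeau r a \<longleftrightarrow> moderate_net r \<and> abs_colombeau r = a"
  by (simp add: cr_colombeau_def colombeau_rel_def negligible_net_zero)

lemma cr_colombeau_ex: "\<exists>r. cr_colombeau r a"
  by (induction a rule: colombeau.abs_induct) (auto simp: cr_colombeau_def)

lemma cr_colombeau_eq_0_iff:
  assumes "cr_colombeau r a"
  shows "a = 0 \<longleftrightarrow> negligible_net r"
proof -
  have "a = 0 \<longleftrightarrow> colombeau_rel r (\<lambda>_. 0)"
    using assms Quotient_rel[OF Quotient_colombeau, of r "\<lambda>_. 0"]
    by (auto simp: cr_colombeau_def zero_colombeau.abs_eq colombeau_rel_def moderate_net_const negligible_net_zero)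
  then show ?thesis
    using assms by (auto simp: cr_colombeau_iff colombeau_rel_def moderate_net_const)
qed

lemma cr_colombeau_const:
  shows cr_colombeau_0: "cr_colombeau (\<lambda>_. 0) 0" and cr_colombeau_1: "cr_colombeau (\<lambda>_. 1) 1"
  by (simp_all add: cr_colombeau_iff moderate_net_const zero_colombeau.abs_eq one_colombeau.abs_eq)

lemma cr_colombeau_add:
  "cr_colombeau r a \<Longrightarrow> cr_colombeau s b \<Longrightarrow> cr_colombeau (\<lambda>\<epsilon>. r \<epsilon> + s \<epsilon>) (a + b)"
  by (auto simp: cr_colombeau_iff moderate_net_add plus_colombeau.abs_eq colombeau_rel_def
      negligible_net_zero)

lemma cr_colombeau_uminus: "cr_colombeau r a \<Longrightarrow> cr_colombeau (\<lambda>\<epsilon>. - r \<epsilon>) (- a)"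
  by (auto simp: cr_colombeau_iff moderate_net_uminus uminus_colombeau.abs_eq colombeau_rel_def
      negligible_net_zero)

lemma cr_colombeau_mult:
  "cr_colombeau r a \<Longrightarrow> cr_colombeau s b \<Longrightarrow> cr_colombeau (\<lambda>\<epsilon>. r \<epsilon> * s \<epsilon>) (a * b)"
  by (auto simp: cr_colombeau_iff moderate_net_mult times_colombeau.abs_eq colombeau_rel_def
      negligible_net_zero)

lemma cr_colombeau_sum:
  "(\<And>i. i \<in> S \<Longrightarrow> cr_colombeau (r i) (a i)) \<Longrightarrow> cr_colombeau (\<lambda>\<epsilon>. \<Sum>i\<in>S. r i \<epsilon>) (\<Sum>i\<in>S. a i)"
  by (induction S rule: infinite_finite_induct) (auto intro: cr_colombeau_0 cr_colombeau_add)

lemma cr_colombeau_prod: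
  "(\<And>i. i \<in> S \<Longrightarrow> cr_colombeau (r i) (a i)) \<Longrightarrow> cr_colombeau (\<lambda>\<epsilon>. \<Prod>i\<in>S. r i \<epsilon>) (\<Prod>i\<in>S. a i)"
  by (induction S rule: infinite_finite_induct) (auto intro: cr_colombeau_1 cr_colombeau_mult)

lemma cr_colombeau_det:
  fixes A :: "'a::real_normed_field colombeau ^ 'n ^ 'n"
  assumes "\<And>i j. cr_colombeau (\<lambda>\<epsilon>. R \<epsilon> $ i $ j) (A $ i $ j)"
  shows "cr_colombeau (\<lambda>\<epsilon>. det (R \<epsilon>)) (det A)"
proof -
  have "cr_colombeau (\<lambda>_. - 1) (- 1 :: 'a colombeau)"
    by (intro cr_colombeau_uminus cr_colombeau_1)
  \<comment> \<open>Signs are only 1 or -1, so these two constants suffice.\<close>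
  then have "cr_colombeau (\<lambda>_. of_int (sign p)) (of_int (sign p) :: 'a colombeau)"
    for p :: "'n \<Rightarrow> 'n"
    by (simp add: sign_def cr_colombeau_1)
  then show ?thesis
    unfolding det_def by (intro cr_colombeau_sum cr_colombeau_mult cr_colombeau_prod assms)
qed

lemma cr_colombeau_matrix_vector_mult:
  assumes "\<And>i j. cr_colombeau (\<lambda>\<epsilon>. R \<epsilon> $ i $ j) (A $ i $ j)"
    and "\<And>j. cr_colombeau (\<lambda>\<epsilon>. y \<epsilon> $ j) (x $ j)"
  shows "cr_colombeau (\<lambda>\<epsilon>. (R \<epsilon> *v y \<epsilon>) $ i) ((A *v x) $ i)"
  unfolding matrix_vector_mult_def by (simp add: assms cr_colombeau_sum cr_colombeau_mult)

section \<open>Criteria for moderate and negligible nets\<close>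

lemma moderate_net_bounded:
  assumes "\<And>\<epsilon>. norm (r \<epsilon>) \<le> c"
  shows "moderate_net r"
  unfolding moderate_net_def
  by (rule exI[of _ 0], rule bigoI[of _ c]) (simp add: assms)

lemma negligible_net_le:
  assumes "negligible_net r" "\<And>\<epsilon>. norm (s \<epsilon>) \<le> c * norm (r \<epsilon>)"
  shows "negligible_net s"
proof -
  have "(\<lambda>\<epsilon>. norm (s \<epsilon>)) \<in> O[at_right 0](\<lambda>\<epsilon>. norm (r \<epsilon>))"
    by (rule bigoI[of _ c]) (simp add: assms)
  then show ?thesis
    using assms(1) unfolding negligible_net_def by (blast intro: landau_o.big_trans)
qed

lemma negligible_net_norm_iff: "negligible_net (\<lambda>\<epsilon>. norm (r \<epsilon>)) \<longleftrightarrow> negligible_net r"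
  by (simp add: negligible_net_def)

lemma negligible_net_sum:
  "(\<And>i. i \<in> S \<Longrightarrow> negligible_net (r i)) \<Longrightarrow> negligible_net (\<lambda>\<epsilon>. \<Sum>i\<in>S. r i \<epsilon>)"
  by (induction S rule: infinite_finite_induct) (auto intro: negligible_net_zero negligible_net_add)

text \<open>Order \<open>m\<close> for \<open>r\<close> follows from order \<open>m * n\<close> for
  its n-th power by taking n-th roots, which turns the constant \<open>c\<close> into
  \<open>root n c\<close>.\<close>

lemma negligible_net_powerD:
  assumes "negligible_net (\<lambda>\<epsilon>. r \<epsilon> ^ n)" "n > 0"
  shows "negligible_net r"
  unfolding negligible_net_def
proof
  fix m :: nat
  have "(\<lambda>\<epsilon>. norm (r \<epsilon> ^ n)) \<in> O[at_right 0](\<lambda>\<epsilon>. \<epsilon> ^ (m * n))"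
    using assms(1) unfolding negligible_net_def by blast
  then obtain c where c: "c > 0"
    "\<forall>\<^sub>F \<epsilon>::real in at_right 0. norm (norm (r \<epsilon> ^ n)) \<le> c * norm (\<epsilon> ^ (m * n))"
    by (elim landau_o.bigE)
  show "(\<lambda>\<epsilon>. norm (r \<epsilon>)) \<in> O[at_right 0](\<lambda>\<epsilon>. \<epsilon> ^ m)"
  proof (rule bigoI[of _ "root n c"])
    show "\<forall>\<^sub>F \<epsilon>::real in at_right 0. norm (norm (r \<epsilon>)) \<le> root n c * norm (\<epsilon> ^ m)"
      using c(2)
    proof eventually_elim
      case (elim \<epsilon>)
      have "norm (r \<epsilon>) ^ n \<le> (root n c * norm (\<epsilon> ^ m)) ^ n"
        using elim c(1) assms(2)
        by (simp add: norm_power power_abs power_mult_distrib power_mult real_root_pow_pos)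
      then show ?case
        using c(1) assms(2) by (simp add: power_mono_iff)
    qed
  qed
qed

section \<open>Eigenvalues\<close>

lemma ex_free_vector_iff_det_eq_0:
  fixes A :: "'a::real_normed_field colombeau ^ 'n ^ 'n"
  shows "(\<exists>x. free_vector x \<and> A *v x = 0) \<longleftrightarrow> det A = 0"
proof
  assume "\<exists>x. free_vector x \<and> A *v x = 0"
  then show "det A = 0"
    using det_vector_mult_eq_zero unfolding free_vector_def by blast
next
  assume det: "det A = 0"
  have "\<exists>r. \<forall>i j. cr_colombeau (r i j) (A $ i $ j)"
    by (intro choice allI cr_colombeau_ex)
  then obtain r where r: "\<And>i j. cr_colombeau (r i j) (A $ i $ j)" by blast
  define R where "R = (\<lambda>\<epsilon>. \<chi> i j. r i j \<epsilon>)"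
  have R: "cr_colombeau (\<lambda>\<epsilon>. R \<epsilon> $ i $ j) (A $ i $ j)" for i j
    using r by (simp add: R_def)
  have negl: "negligible_net (\<lambda>\<epsilon>. det (R \<epsilon>))"
    using cr_colombeau_det[OF R] det cr_colombeau_eq_0_iff by blast
  have "\<forall>\<epsilon>. \<exists>x. (\<forall>i. norm (x $ i) \<le> 1) \<and> (\<exists>i. norm (x $ i) = 1) \<and>
    (\<forall>i. norm ((R \<epsilon> *v x) $ i) ^ CARD('n) \<le> fact CARD('n) * norm (det (R \<epsilon>)))"
    by (intro allI ex_almost_null_vector)
  \<comment> \<open>The vectors are chosen independently for each \<epsilon>. No regularity in
    \<epsilon> is required of a net, and \<open>y1\<close> alone makes the entries moderate.\<close>
  then obtain y where y1: "\<And>\<epsilon> i. norm (y \<epsilon> $ i) \<le> 1" and y2: "\<And>\<epsilon>. \<exists>i. norm (y \<epsilon> $ i) = 1"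
    and y3: "\<And>\<epsilon> i. norm ((R \<epsilon> *v y \<epsilon>) $ i) ^ CARD('n) \<le> fact CARD('n) * norm (det (R \<epsilon>))"
    by metis
  define x where "x = (\<chi> i. abs_colombeau (\<lambda>\<epsilon>. y \<epsilon> $ i))"
  have x: "cr_colombeau (\<lambda>\<epsilon>. y \<epsilon> $ i) (x $ i)" for i
    using moderate_net_bounded[of "\<lambda>\<epsilon>. y \<epsilon> $ i" 1] y1 by (simp add: cr_colombeau_iff x_def)
  have "(A *v x) $ i = 0" for i
  proof -
    have "negligible_net (\<lambda>\<epsilon>. (R \<epsilon> *v y \<epsilon>) $ i ^ CARD('n))"
      by (rule negligible_net_le[OF negl, where c = "fact CARD('n)"]) (simp add: norm_power y3)
    then have "negligible_net (\<lambda>\<epsilon>. (R \<epsilon> *v y \<epsilon>) $ i)"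
      by (rule negligible_net_powerD) simp
    then show ?thesis
      using cr_colombeau_matrix_vector_mult[OF R x] cr_colombeau_eq_0_iff by blast
  qed
  moreover have "free_vector x"
    unfolding free_vector_def
  proof (intro allI impI)
    fix \<mu> assume \<mu>: "\<mu> *s x = 0"
    obtain m where m: "cr_colombeau m \<mu>" using cr_colombeau_ex by blast
    have "negligible_net (\<lambda>\<epsilon>. m \<epsilon> * y \<epsilon> $ i)" for i
    proof -
      have "\<mu> * x $ i = 0" using \<mu> by (simp add: vec_eq_iff)
      then show ?thesis
        using cr_colombeau_mult[OF m x] cr_colombeau_eq_0_iff by blast
    qed
    \<comment> \<open>The index at which \<open>y\<close> has norm 1 may vary with \<epsilon>, so no
      single entry need control \<open>m\<close>. The sum over all entries dominates
      \<open>norm (m \<epsilon>)\<close> for every \<epsilon>.\<close>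
    then have *: "negligible_net (\<lambda>\<epsilon>. \<Sum>i\<in>UNIV. norm (m \<epsilon> * y \<epsilon> $ i))"
      by (intro negligible_net_sum) (simp add: negligible_net_norm_iff)
    have "norm (m \<epsilon>) \<le> 1 * norm (\<Sum>i\<in>UNIV. norm (m \<epsilon> * y \<epsilon> $ i))" for \<epsilon>
    proof -
      obtain i where "norm (y \<epsilon> $ i) = 1" using y2 by blast
      then have "norm (m \<epsilon>) = norm (m \<epsilon> * y \<epsilon> $ i)" by (simp add: norm_mult)
      also have "\<dots> \<le> (\<Sum>i\<in>UNIV. norm (m \<epsilon> * y \<epsilon> $ i))"
        by (rule member_le_sum) auto
      finally show ?thesis by simp
    qed
    with * have "negligible_net m" by (rule negligible_net_le)
    then show "\<mu> = 0" using m cr_colombeau_eq_0_iff by blast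
  qed
  ultimately show "\<exists>x. free_vector x \<and> A *v x = 0"
    by (auto simp: vec_eq_iff)
qed

lemma mat_mult_vector: "mat c *v x = (c :: 'a::comm_ring_1) *s x"
  by (simp add: vec_eq_iff matrix_vector_mult_def mat_def if_distrib[of "\<lambda>u. u * _"] cong: if_cong)

lemma gen_eigenvalue_iff: "gen_eigenvalue A l \<longleftrightarrow> det (A - mat l) = 0"
  unfolding gen_eigenvalue_def ex_free_vector_iff_det_eq_0[symmetric]
  by (simp add: matrix_vector_mult_diff_rdistrib mat_mult_vector)

lemma gen_eigenvalue_invertible_dvd_one:
  assumes "invertible A" "gen_eigenvalue A l"
  shows "l dvd 1"
proof -
  \<comment> \<open>The entries of \<open>A\<close> and \<open>A - mat l\<close> differ by
    \<open>l\<close> or 0. As the second determinant vanishes, \<open>l\<close> divides the unit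
    \<open>det A\<close>.\<close>
  have "l dvd det A - det (A - mat l)"
    by (rule dvd_det_diff) (simp add: mat_def)
  then have "l dvd det A"
    using assms(2) by (simp add: gen_eigenvalue_iff)
  then show ?thesis
    using det_invertible_dvd_one[OF assms(1)] dvd_trans by blast
qed

section \<open>Symplectic matrices\<close>

lemma cr_complex_of_colombeau:
  "cr_colombeau r a \<Longrightarrow> cr_colombeau (\<lambda>\<epsilon>. complex_of_real (r \<epsilon>)) (complex_of_colombeau a)"
  using complex_of_colombeau.abs_eq[of r]
  by (auto simp: cr_colombeau_def colombeau_rel_def negligible_net_zero moderate_net_def)

text \<open>Reduces each homomorphism law to exhibiting one net that represents both sides.\<close>

lemma complex_of_colombeau_unique:
  "cr_colombeau r a \<Longrightarrow> cr_colombeau (\<lambda>\<epsilon>. complex_of_real (r \<epsilon>)) b \<Longrightarrow> complex_of_colombeau a = b"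
  using cr_complex_of_colombeau by (fastforce simp: cr_colombeau_iff)

lemma complex_of_colombeau_0 [simp]: "complex_of_colombeau 0 = 0"
  by (rule complex_of_colombeau_unique[OF cr_colombeau_0]) (simp add: cr_colombeau_0)

lemma complex_of_colombeau_1 [simp]: "complex_of_colombeau 1 = 1"
  by (rule complex_of_colombeau_unique[OF cr_colombeau_1]) (simp add: cr_colombeau_1)

lemma complex_of_colombeau_uminus [simp]: "complex_of_colombeau (- a) = - complex_of_colombeau a"
proof -
  obtain r where *: "cr_colombeau r a" using cr_colombeau_ex by blast
  show ?thesis
    by (rule complex_of_colombeau_unique[OF cr_colombeau_uminus[OF *]])
      (simp add: * cr_colombeau_uminus cr_complex_of_colombeau)
qed

lemma complex_of_colombeau_add [simp]:
  "complex_of_colombeau (a + b) = complex_of_colombeau a + complex_of_colombeau b"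
proof -
  obtain r s where *: "cr_colombeau r a" "cr_colombeau s b" using cr_colombeau_ex by blast
  show ?thesis
    by (rule complex_of_colombeau_unique[OF cr_colombeau_add[OF *]])
      (simp add: * cr_colombeau_add cr_complex_of_colombeau)
qed

lemma complex_of_colombeau_mult [simp]:
  "complex_of_colombeau (a * b) = complex_of_colombeau a * complex_of_colombeau b"
proof -
  obtain r s where *: "cr_colombeau r a" "cr_colombeau s b" using cr_colombeau_ex by blast
  show ?thesis
    by (rule complex_of_colombeau_unique[OF cr_colombeau_mult[OF *]])
      (simp add: * cr_colombeau_mult cr_complex_of_colombeau)
qed

lemma complex_of_colombeau_sum: "complex_of_colombeau (sum f S) = (\<Sum>i\<in>S. complex_of_colombeau (f i))"
  by (induction S rule: infinite_finite_induct) auto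

lemma complex_matrix_of_colombeau_mult:
  "complex_matrix_of_colombeau (A ** B) =
    complex_matrix_of_colombeau A ** complex_matrix_of_colombeau B"
  by (simp add: vec_eq_iff complex_matrix_of_colombeau_def matrix_matrix_mult_def
      complex_of_colombeau_sum)

lemma complex_matrix_of_colombeau_transpose:
  "complex_matrix_of_colombeau (transpose A) = transpose (complex_matrix_of_colombeau A)"
  by (simp add: vec_eq_iff complex_matrix_of_colombeau_def transpose_def)

lemma complex_matrix_of_colombeau_symplectic_J:
  "complex_matrix_of_colombeau symplectic_J = symplectic_J"
  by (auto simp: vec_eq_iff complex_matrix_of_colombeau_def symplectic_J_def split: sum.split)

text \<open>The rows of J are orthonormal. This serves to show that \<open>det symplectic_J\<close>
  squares to 1.\<close>

lemma symplectic_J_mult_transpose: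
  "symplectic_J ** transpose symplectic_J = (mat 1 :: 'a::comm_ring_1 ^ ('n::finite + 'n) ^ ('n + 'n))"
proof -
  have "(\<Sum>k\<in>UNIV. symplectic_J $ i $ k * symplectic_J $ j $ k) = (if i = j then 1 else 0 :: 'a)"
    for i j :: "'n + 'n"
    unfolding UNIV_Plus_UNIV[symmetric] sum.Plus[OF finite finite]
    by (cases i; cases j) (auto simp: symplectic_J_def if_distrib[of "\<lambda>u. u * _"] cong: if_cong)
  then show ?thesis
    by (simp add: vec_eq_iff matrix_matrix_mult_def transpose_def mat_def)
qed

lemma mat_matrix_mult: "(mat c ** A) $ i $ j = (c :: 'a::comm_ring_1) * A $ i $ j"
  by (simp add: matrix_matrix_mult_def mat_def if_distrib[of "\<lambda>u. u * _"] cong: if_cong)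

lemma matrix_mult_mat: "(A ** mat c) $ i $ j = (c :: 'a::comm_ring_1) * A $ i $ j"
  by (simp add: matrix_matrix_mult_def mat_def if_distrib[of "\<lambda>u. _ * u"] mult.commute cong: if_cong)

lemma matrix_sub_ldistrib: "A ** (B - C) = A ** B - A ** (C :: 'a::comm_ring_1 ^ 'p ^ 'n)"
  by (simp add: vec_eq_iff matrix_matrix_mult_def right_diff_distrib sum_subtractf)

lemma matrix_sub_rdistrib: "(A - B) ** C = A ** C - B ** (C :: 'a::comm_ring_1 ^ 'p ^ 'n)"
  by (simp add: vec_eq_iff matrix_matrix_mult_def left_diff_distrib sum_subtractf)

text \<open>Multiplying \<open>transpose A - mat l'\<close> by \<open>J ** A\<close> on the right gives \<open>- l'\<close> times \<open>J ** (A - mat l)\<close>.\<close>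

lemma symplectic_det_eq_0:
  fixes A :: "'a::comm_ring_1 ^ ('n::finite + 'n) ^ ('n + 'n)"
  assumes A: "transpose A ** symplectic_J ** A = symplectic_J"
    and l: "l * l' = 1" and det: "det (A - mat l) = 0"
  shows "det (A - mat l') = 0"
proof -
  let ?J = "symplectic_J :: 'a ^ ('n + 'n) ^ ('n + 'n)"
  \<comment> \<open>Cancelling in a ring with zero divisors needs units: \<open>det ?J\<close> and
    \<open>det A\<close> both turn out to have square 1.\<close>
  have detJ: "det ?J * det ?J = 1"
    using arg_cong[OF symplectic_J_mult_transpose, of det] by (simp add: det_mul)
  have "det A * det ?J * det A = det ?J"
    using arg_cong[OF A, of det] by (simp add: det_mul)
  then have "det A * det A * (det ?J * det ?J) = det ?J * det ?J"
    by (metis mult.assoc mult.commute)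
  then have detA: "det A * det A = 1"
    by (simp add: detJ)
  have "(transpose A - mat l') ** (?J ** A) = ?J - mat l' ** (?J ** A)"
    using A by (simp add: matrix_sub_rdistrib matrix_mul_assoc)
  also have "\<dots> = mat (- l') ** (?J ** (A - mat l))"
  proof -
    \<comment> \<open>The matrix identity entry by entry: \<open>j\<close> is an entry of
      \<open>?J\<close> and \<open>a\<close> one of \<open>?J ** A\<close>. It uses that
      \<open>l' * (l * j)\<close> equals \<open>j\<close>.\<close>
    have "j - l' * a = - l' * a - - l' * (l * j)" for j a :: 'a
      using l by (simp add: algebra_simps flip: mult.assoc)
    then show ?thesis
      by (simp only: vec_eq_iff vector_minus_component mat_matrix_mult matrix_sub_ldistrib
          matrix_mult_mat simp_thms)
  qed
  finally have "det ((transpose A - mat l') ** (?J ** A)) = det \<dots>"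
    by (rule arg_cong)
  \<comment> \<open>The right side vanishes through its factor \<open>det (A - mat l)\<close>.
    Multiplying by a second \<open>det ?J * det A\<close> leaves only squares to remove.\<close>
  then have "det (transpose A - mat l') * (det ?J * det A) * (det ?J * det A) = 0"
    by (simp add: det_mul det)
  then have "det (transpose A - mat l') * (det ?J * det ?J) * (det A * det A) = 0"
    by (simp only: mult_ac)
  then have "det (transpose A - mat l') = 0"
    by (simp add: detJ detA)
  moreover have "transpose A - mat l' = transpose (A - mat l')"
    by (auto simp: vec_eq_iff transpose_def mat_def)
  ultimately show ?thesis
    by simp
qed

text \<open>The embedding is a ring homomorphism that maps J to J, so the symplectic identity
  carries over to the complex matrix.\<close>

lemma symplectic_gen_eigenvalue_inverse:
  assumes "symplectic_matrix A" "l * l' = 1" "gen_eigenvalue (complex_matrix_of_colombeau A) l"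
  shows "gen_eigenvalue (complex_matrix_of_colombeau A) l'"
proof -
  have "transpose (complex_matrix_of_colombeau A) ** symplectic_J ** complex_matrix_of_colombeau A
      = symplectic_J"
    using assms(1) unfolding symplectic_matrix_def
    by (metis complex_matrix_of_colombeau_mult complex_matrix_of_colombeau_transpose
        complex_matrix_of_colombeau_symplectic_J)
  then show ?thesis
    using symplectic_det_eq_0[OF _ assms(2)] assms(3) unfolding gen_eigenvalue_iff by blast
qed

theorem proposition3p20:
  shows
    "(\<forall>(A :: complex colombeau ^ 'n ^ 'n) (l :: complex colombeau).
        gen_eigenvalue A l \<longleftrightarrow> det (A - mat l) = 0)
   \<and> (\<forall>(A :: complex colombeau ^ 'n ^ 'n) (l :: complex colombeau).
        invertible A \<longrightarrow> gen_eigenvalue A l \<longrightarrow> l dvd 1)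
   \<and> (\<forall>(A :: real colombeau ^ ('n + 'n) ^ ('n + 'n)) (l :: complex colombeau)
        (l' :: complex colombeau).
        symplectic_matrix A \<longrightarrow> l * l' = 1 \<longrightarrow>
          (gen_eigenvalue (complex_matrix_of_colombeau A) l \<longleftrightarrow>
           gen_eigenvalue (complex_matrix_of_colombeau A) l'))"
proof (intro conjI allI impI)
  fix A :: "complex colombeau ^ 'n ^ 'n" and l
  show "gen_eigenvalue A l \<longleftrightarrow> det (A - mat l) = 0"
    by (rule gen_eigenvalue_iff)
next
  fix A :: "complex colombeau ^ 'n ^ 'n" and l
  assume "invertible A" "gen_eigenvalue A l"
  then show "l dvd 1"
    by (rule gen_eigenvalue_invertible_dvd_one)
next
  fix A :: "real colombeau ^ ('n + 'n) ^ ('n + 'n)" and l l' :: "complex colombeau"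
  assume A: "symplectic_matrix A" and l: "l * l' = 1"
  \<comment> \<open>The hypotheses are symmetric in \<open>l\<close> and \<open>l'\<close>, so one
    implication used twice gives the equivalence.\<close>
  then have l': "l' * l = 1" by (simp add: mult.commute)
  show "gen_eigenvalue (complex_matrix_of_colombeau A) l \<longleftrightarrow>
      gen_eigenvalue (complex_matrix_of_colombeau A) l'"
    using symplectic_gen_eigenvalue_inverse[OF A l] symplectic_gen_eigenvalue_inverse[OF A l']
    by (rule iffI)
qed

end
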